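(* Let $P$ be a poset equipped with the upper convexity (resp. the lower convexity) and with a lower semiclosed (resp. an upper semiclosed) topology. Then every compact subset $K$ of $P$ satisfies $$\operatorname{co}(K)=\operatorname{co}(\operatorname{ex}K).$$
   Context: For a poset $(P,\leqslant)$ and $A\subset P$, $\downarrow A=\{x: x\leqslant a \text{ for some } a\in A\}$, $\uparrow A=\{x : x\geqslant a\text{ for some }a\in A\}$, $\downarrow x=\downarrow\{x\}$, $\uparrow x=\uparrow\{x\}$. In the upper (resp. lower) convexity, the convex subsets are the upper subsets $A=\uparrow A$ (resp. the lower subsets $A=\downarrow A$). $\operatorname{co}(A)$ is the intersection of all convex subsets containing $A$. A point $x\in A$ is an extreme point of a subset $A\subset P$ if $x\notin\operatorname{co}(A\setminus\{x\})$; $\operatorname{ex}A$ is the set of extreme points of $A$. A topology on $P$ is lower semiclosed (resp. upper semiclosed) if each $\downarrow x$ (resp. each $\uparrow x$) is a closed subset. Compactness does not include Hausdorffness. *)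

theory Defs
  imports Complex_Main "HOL.Hull"
begin

definition downset :: "'a::order set \<Rightarrow> 'a set"
  where "downset A = {x. \<exists>a\<in>A. x \<le> a}"

definition upset :: "'a::order set \<Rightarrow> 'a set"
  where "upset A = {x. \<exists>a\<in>A. a \<le> x}"

definition upper_convex :: "'a::order set \<Rightarrow> bool"
  where "upper_convex A \<longleftrightarrow> A = upset A"

definition lower_convex :: "'a::order set \<Rightarrow> bool"
  where "lower_convex A \<longleftrightarrow> A = downset A"

(* For a convexity given by its predicate C of convex sets, co(A) is the library's "C hull A",
   i.e. the intersection of all sets t with "C t" and "A \<subseteq> t". *)
definition extreme_points :: "('a set \<Rightarrow> bool) \<Rightarrow> 'a set \<Rightarrow> 'a set"
  where "extreme_points C A = {x \<in> A. x \<notin> C hull (A - {x})}"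

(* The classes order and topological_space are independent: in the sort
   {order, topological_space} the topology is arbitrary, not the order topology. *)
definition lower_semiclosed :: "'a::{order,topological_space} itself \<Rightarrow> bool"
  where "lower_semiclosed _ \<longleftrightarrow> (\<forall>x::'a. closed (downset {x}))"

definition upper_semiclosed :: "'a::{order,topological_space} itself \<Rightarrow> bool"
  where "upper_semiclosed _ \<longleftrightarrow> (\<forall>x::'a. closed (upset {x}))"

end

theory Submission
  imports Defs
begin

text \<open>
  The convex hull of a set for the upper convexity is its up-closure, so the extreme points of
  \<open>K\<close> are exactly its minimal elements. The claim therefore says that every point of \<open>K\<close> lies above
  a minimal element of \<open>K\<close>. This is Zorn's lemma: for a chain \<open>C\<close> in \<open>K\<close>, the sets
  \<open>K \<inter> {y. y \<le> c}\<close> with \<open>c \<in> C\<close> are closed in the compact set \<open>K\<close> and have the finite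
  intersection property, because a finite part of a chain has a least member; a common point of
  all of them is a lower bound of \<open>C\<close> in \<open>K\<close>.

  The lower convexity is the same statement for the reversed order. To have one proof for both,
  the lemmas are about an arbitrary partial order \<open>R\<close>, which is then
  instantiated to \<open>\<le>\<close> and to \<open>\<ge>\<close>.
\<close>

lemma finite_subset_chain_lower_bound:
  assumes "finite F" and "F \<subseteq> C" and "C \<noteq> {}"
    and "reflp R" and "transp R"
    and chain: "\<And>a b. a \<in> C \<Longrightarrow> b \<in> C \<Longrightarrow> R a b \<or> R b a"
  shows "\<exists>u\<in>C. \<forall>a\<in>F. R u a"
  using assms(1,2)
proof (induction F rule: finite_induct)
  case empty
  then show ?case using \<open>C \<noteq> {}\<close> by blast
next
  case (insert b F)
  then obtain u where u: "u \<in> C" "\<forall>a\<in>F. R u a" and b: "b \<in> C" by auto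
  from chain[OF u(1) b] show ?case
  proof
    assume "R u b"
    then show ?thesis using u by blast
  next
    assume "R b u"
    then have "\<forall>a\<in>insert b F. R b a"
      using u(2) \<open>reflp R\<close> \<open>transp R\<close> by (auto dest: reflpD transpD)
    then show ?thesis using b by blast
  qed
qed

text \<open>Compactness replaces the missing infimum: the principal down-sets of the members of a chain
  are closed and nested, hence have a common point in \<open>K\<close>.\<close>

lemma compact_chain_lower_bound:
  fixes K :: "'a::topological_space set"
  assumes "compact K" and "C \<subseteq> K" and "C \<noteq> {}"
    and "reflp R" and "transp R"
    and closed: "\<And>x. closed {y. R y x}"
    and chain: "\<And>a b. a \<in> C \<Longrightarrow> b \<in> C \<Longrightarrow> R a b \<or> R b a"
  shows "\<exists>u\<in>K. \<forall>a\<in>C. R u a"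
proof -
  have "K \<inter> (\<Inter>c\<in>C. {y. R y c}) \<noteq> {}"
  proof (rule compact_imp_fip_image[OF \<open>compact K\<close>])
    show "closed {y. R y c}" for c by (rule closed)
    show "K \<inter> (\<Inter>c\<in>F. {y. R y c}) \<noteq> {}" if "finite F" "F \<subseteq> C" for F
      using finite_subset_chain_lower_bound[OF that \<open>C \<noteq> {}\<close> \<open>reflp R\<close> \<open>transp R\<close> chain] \<open>C \<subseteq> K\<close>
      by blast
  qed
  then show ?thesis by blast
qed

lemma compact_minimal_below:
  fixes K :: "'a::topological_space set"
  assumes "compact K" and "x \<in> K"
    and "reflp R" and "transp R" and "antisymp R"
    and closed: "\<And>x. closed {y. R y x}"
  shows "\<exists>m\<in>K. R m x \<and> (\<forall>y\<in>K. R y m \<longrightarrow> y = m)"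
proof -
  let ?A = "{y \<in> K. R y x}" and ?G = "\<lambda>a b. R b a"
  have "\<exists>m\<in>?A. \<forall>a\<in>?A. ?G m a \<longrightarrow> a = m"
  proof (rule predicate_Zorn)
    show "partial_order_on ?A (relation_of ?G ?A)"
      using assms(3-5)
      by (intro partial_order_on_relation_ofI) (auto dest: reflpD transpD antisympD)
  next
    fix C assume C: "C \<in> Chains (relation_of ?G ?A)"
    then have CA: "C \<subseteq> ?A" and chain: "\<And>a b. a \<in> C \<Longrightarrow> b \<in> C \<Longrightarrow> R a b \<or> R b a"
      unfolding Chains_def relation_of_def by blast+
    \<comment> \<open>Adjoining \<open>x\<close> makes the chain nonempty and forces its lower bound to lie below \<open>x\<close>.\<close>
    have "\<exists>u\<in>K. \<forall>a\<in>insert x C. R u a"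
    proof (rule compact_chain_lower_bound[OF \<open>compact K\<close> _ _ \<open>reflp R\<close> \<open>transp R\<close> closed])
      show "R a b \<or> R b a" if "a \<in> insert x C" "b \<in> insert x C" for a b
        using that CA chain \<open>reflp R\<close> by (auto dest: reflpD)
    qed (use CA \<open>x \<in> K\<close> in auto)
    then show "\<exists>u\<in>?A. \<forall>a\<in>C. ?G a u" by blast
  qed
  then show ?thesis using \<open>transp R\<close> by (blast dest: transpD)
qed

lemma up_closed_hull:
  assumes convex: "\<And>A. cvx A \<longleftrightarrow> A = {x. \<exists>a\<in>A. R a x}"
    and "reflp R" and "transp R"
  shows "cvx hull S = {x. \<exists>a\<in>S. R a x}"
proof (rule hull_unique)
  show "S \<subseteq> {x. \<exists>a\<in>S. R a x}" using \<open>reflp R\<close> by (blast dest: reflpD)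
  show "cvx {x. \<exists>a\<in>S. R a x}"
    unfolding convex using \<open>reflp R\<close> \<open>transp R\<close> by (blast dest: reflpD transpD)
  show "{x. \<exists>a\<in>S. R a x} \<subseteq> T" if "S \<subseteq> T" "cvx T" for T
    using that unfolding convex by blast
qed

text \<open>The hull formula turns the extreme points into the minimal elements, and transitivity carries
  a minimal element below \<open>a \<in> K\<close> to every point above \<open>a\<close>.\<close>

lemma compact_up_closed_hull_extreme_points:
  fixes K :: "'a::topological_space set"
  assumes convex: "\<And>A. cvx A \<longleftrightarrow> A = {x. \<exists>a\<in>A. R a x}"
    and "compact K"
    and "reflp R" and "transp R" and "antisymp R"
    and closed: "\<And>x. closed {y. R y x}"
  shows "cvx hull K = cvx hull (extreme_points cvx K)"
proof -
  note hull = up_closed_hull[of cvx, OF convex \<open>reflp R\<close> \<open>transp R\<close>]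
  have extreme: "extreme_points cvx K = {m \<in> K. \<forall>y\<in>K. R y m \<longrightarrow> y = m}"
    unfolding extreme_points_def hull by blast
  show ?thesis
  proof
    show "cvx hull K \<subseteq> cvx hull (extreme_points cvx K)"
      unfolding hull extreme
      using compact_minimal_below[OF \<open>compact K\<close> _ assms(3-5) closed] \<open>transp R\<close>
      by (blast dest: transpD)
    show "cvx hull (extreme_points cvx K) \<subseteq> cvx hull K"
      by (rule hull_mono) (auto simp: extreme_points_def)
  qed
qed

theorem theorem3p3:
  shows "(lower_semiclosed TYPE('a::{order,topological_space}) \<longrightarrow>
           (\<forall>K::'a set. compact K \<longrightarrow>
              upper_convex hull K = upper_convex hull (extreme_points upper_convex K)))
       \<and> (upper_semiclosed TYPE('a) \<longrightarrow>
           (\<forall>K::'a set. compact K \<longrightarrow>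
              lower_convex hull K = lower_convex hull (extreme_points lower_convex K)))"
proof (intro conjI impI allI)
  fix K :: "'a set"
  assume "lower_semiclosed TYPE('a)" and "compact K"
  then show "upper_convex hull K = upper_convex hull (extreme_points upper_convex K)"
    by (intro compact_up_closed_hull_extreme_points[where R = "(\<le>)"])
      (auto simp: upper_convex_def upset_def lower_semiclosed_def downset_def
        intro: reflpI transpI antisympI)
next
  fix K :: "'a set"
  assume "upper_semiclosed TYPE('a)" and "compact K"
  then show "lower_convex hull K = lower_convex hull (extreme_points lower_convex K)"
    by (intro compact_up_closed_hull_extreme_points[where R = "(\<ge>)"])
      (auto simp: lower_convex_def downset_def upper_semiclosed_def upset_def
        intro: reflpI transpI antisympI)
qed

end
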